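(* Let $p$ and $q$ be odd prime numbers with $p\equiv 3 \pmod 8$ and $q\equiv 3\pmod 8$, such that $p<q$ and $(p-1)\nmid(q-1)$. Then $\mathbb{Z}_{pq}$ admits a strong Skolem starter.
   Context: Let $n=2k+1$ be odd, let $\mathbb{Z}_n$ be the additive group of integers modulo $n$, and let $\mathbb{Z}_n^*=\mathbb{Z}_n\setminus\{0\}$ denote its set of non-zero elements, ordered via representatives as $1<2<\cdots<2k$. A starter for $\mathbb{Z}_n$ is a set $S=\{\{x_i,y_i\}: i=1,\ldots,k\}$ of pairs of elements of $\mathbb{Z}_n^*$ such that $\bigcup_{i=1}^k\{x_i,y_i\}=\mathbb{Z}_n^*$ and $\{\pm(x_i-y_i): i=1,\ldots,k\}=\mathbb{Z}_n^*$. A starter is strong if the sums $x_i+y_i$ (in $\mathbb{Z}_n$), $i=1,\ldots,k$, are all non-zero and pairwise different. A starter for $\mathbb{Z}_n$ is Skolem if it can be written as $S=\{\{x_i,y_i\}: i=1,\ldots,k\}$ with $y_i>x_i$ (in the order $1<2<\cdots<2k$) and $y_i-x_i\equiv i\pmod n$ for $i=1,\ldots,k$. A strong Skolem starter is a starter that is both strong and Skolem. *)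

theory Defs
  imports "HOL-Number_Theory.Number_Theory"
begin

text \<open>
  Elements of $Z_n$ are represented by the integers $0, \dots, n - 1$, with arithmetic taken
  modulo $n$; the order on these representatives is the usual order of the integers.
\<close>

definition nonzero_residues :: "nat \<Rightarrow> int set" where
  "nonzero_residues n = {1..<int n}"

text \<open>
  For odd $n = 2k + 1$, a family of $k$ unordered pairs is written as
  $\{\{x_i, y_i\} : i = 1, \dots, k\}$. The functions \<open>x\<close> and \<open>y\<close> only matter on the indices
  $1, \dots, k$, and $k$ is \<open>n div 2\<close>.
\<close>

definition enumerates :: "nat \<Rightarrow> int set set \<Rightarrow> (nat \<Rightarrow> int) \<Rightarrow> (nat \<Rightarrow> int) \<Rightarrow> bool" where
  "enumerates n S x y \<longleftrightarrow> S = (\<lambda>i. {x i, y i}) ` {1..n div 2}"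

definition starter :: "nat \<Rightarrow> int set set \<Rightarrow> bool" where
  "starter n S \<longleftrightarrow> odd n \<and>
     (\<exists>x y. enumerates n S x y \<and>
        (\<Union>i\<in>{1..n div 2}. {x i, y i}) = nonzero_residues n \<and>
        (\<Union>i\<in>{1..n div 2}. {(x i - y i) mod int n, (- (x i - y i)) mod int n})
          = nonzero_residues n)"

text \<open>
  A starter consists of exactly $k$ pairs, since these pairs cover $2k$ elements. Hence all its
  enumerations agree up to reordering the indices and swapping \<open>x i\<close> with \<open>y i\<close>, and the
  condition on the sums does not depend on the enumeration.
\<close>

definition strong_starter :: "nat \<Rightarrow> int set set \<Rightarrow> bool" where
  "strong_starter n S \<longleftrightarrow> starter n S \<and>
     (\<exists>x y. enumerates n S x y \<and>
        (\<forall>i\<in>{1..n div 2}. (x i + y i) mod int n \<noteq> 0) \<and>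
        inj_on (\<lambda>i. (x i + y i) mod int n) {1..n div 2})"

definition skolem_starter :: "nat \<Rightarrow> int set set \<Rightarrow> bool" where
  "skolem_starter n S \<longleftrightarrow> starter n S \<and>
     (\<exists>x y. enumerates n S x y \<and>
        (\<forall>i\<in>{1..n div 2}. x i < y i \<and> [y i - x i = int i] (mod int n)))"

definition strong_skolem_starter :: "nat \<Rightarrow> int set set \<Rightarrow> bool" where
  "strong_skolem_starter n S \<longleftrightarrow> strong_starter n S \<and> skolem_starter n S"

end

theory Submission
  imports Defs
begin

text \<open>
  The starter consists of pairs \<open>{z, 2z}\<close>. A set \<open>H\<close> of non-zero residues modulo an odd \<open>n\<close> such
  that exactly one of \<open>z\<close>, \<open>-z\<close> and exactly one of \<open>z\<close>, \<open>2z\<close> lies in \<open>H\<close> satisfies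
  \<open>H \<union> 2H = H \<union> -H = \<int>\<^sub>n\<^sup>*\<close>, so the pairs \<open>{z, 2z}\<close> with \<open>z \<in> H\<close> cover \<open>\<int>\<^sub>n\<^sup>*\<close>, and so do
  their differences \<open>\<plusminus>z\<close>. Three points then make this starter strong and Skolem.

  \<^item> The representatives of \<open>z\<close> and \<open>2z\<close> differ by \<open>z\<close> if \<open>2z < n\<close> and by \<open>n - z\<close> otherwise, which is
    in both cases the representative of \<open>\<plusminus>z\<close> in \<open>{1..n div 2}\<close>. So the pairs are Skolem
    whatever \<open>H\<close> is.
  \<^item> The sums are \<open>3z\<close>; if \<open>3\<close> is coprime to \<open>n\<close>, they are non-zero and pairwise different.
  \<^item> For a prime \<open>r\<close> congruent to \<open>3\<close> modulo \<open>8\<close>, both \<open>-1\<close> and \<open>2\<close> are quadratic non-residues (the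
    latter by Gauss' lemma), so negation and doubling both reverse the Legendre symbol.

  For \<open>n = p * q\<close>, membership in \<open>H\<close> can therefore be read off from the Legendre symbol modulo
  \<open>p\<close> when \<open>z\<close> is not a multiple of \<open>p\<close>, and from the one modulo \<open>q\<close> when it is. Since \<open>q\<close> is odd,
  \<open>p - 1\<close> not dividing \<open>q - 1\<close> excludes \<open>p = 3\<close>, which gives the coprimality with \<open>3\<close>.
\<close>

section \<open>Starters from a half-set alternating under negation and doubling\<close>

text \<open>
  The half-set is a predicate on the representatives \<open>0 < z < n\<close>. It suffices to compare \<open>z\<close> and
  \<open>2z\<close> when \<open>2z\<close> needs no reduction: for the other \<open>z\<close>, apply this to \<open>n - z\<close>.
\<close>

locale alternating_half_set =
  fixes n :: nat and H :: "int \<Rightarrow> bool"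
  assumes odd_n: "odd n"
    and coprime_3: "coprime 3 (int n)"
    and H_neg: "\<And>z. 0 < z \<Longrightarrow> z < int n \<Longrightarrow> H (int n - z) \<longleftrightarrow> \<not> H z"
    and H_double: "\<And>z. 0 < z \<Longrightarrow> 2 * z < int n \<Longrightarrow> H (2 * z) \<longleftrightarrow> \<not> H z"
begin

text \<open>
  For \<open>i\<close> in \<open>{1..n div 2}\<close> exactly one of \<open>i\<close> and \<open>n - i\<close> is in the half-set, and the pair with
  difference \<open>i\<close> consists of this element and its double, reduced modulo \<open>n\<close>.
\<close>

definition lo :: "nat \<Rightarrow> int" where
  "lo i = (if H (int i) then int i else int n - 2 * int i)"

definition hi :: "nat \<Rightarrow> int" where
  "hi i = (if H (int i) then 2 * int i else int n - int i)"

lemma hi_minus_lo: "hi i - lo i = int i"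
  by (simp add: lo_def hi_def)

lemma index_bound: "i \<in> {1..n div 2} \<Longrightarrow> 0 < int i \<and> 2 * int i < int n"
  using odd_n by (auto elim!: oddE)

lemma index_of_nonzero:
  assumes "0 < w" "2 * w < int n"
  obtains i where "i \<in> {1..n div 2}" "int i = w"
  using assms by (intro that[of "nat w"]) auto

text \<open>
  An element \<open>z\<close> of the half-set occurs next to \<open>2z\<close>, with index \<open>z\<close> or \<open>n - z\<close>. An element outside
  of it occurs as a double: one of \<open>z\<close>, \<open>n - z\<close> is even since \<open>n\<close> is odd, and half of it is the
  index.
\<close>

lemma pairs_cover: "(\<Union>i\<in>{1..n div 2}. {lo i, hi i}) = nonzero_residues n"
proof
  show "(\<Union>i\<in>{1..n div 2}. {lo i, hi i}) \<subseteq> nonzero_residues n"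
    using index_bound by (fastforce simp: lo_def hi_def nonzero_residues_def)
next
  show "nonzero_residues n \<subseteq> (\<Union>i\<in>{1..n div 2}. {lo i, hi i})"
  proof
    fix z assume "z \<in> nonzero_residues n"
    then have z: "0 < z" "z < int n"
      by (auto simp: nonzero_residues_def)
    have "\<exists>i\<in>{1..n div 2}. z = lo i \<or> z = hi i"
    proof (cases "H z")
      case True
      show ?thesis
      proof (cases "2 * z < int n")
        case small: True
        then obtain i where "i \<in> {1..n div 2}" "int i = z"
          using z index_of_nonzero by blast
        then show ?thesis
          using True by (intro bexI[of _ i]) (auto simp: lo_def)
      next
        case False
        moreover have "int n \<noteq> 2 * z"
          using odd_n by presburger
        ultimately obtain i where i: "i \<in> {1..n div 2}" "int i = int n - z"
          using z index_of_nonzero[of "int n - z"] by auto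
        have "\<not> H (int i)"
          using True H_neg[OF z] i by simp
        then show ?thesis
          using i by (intro bexI[of _ i]) (auto simp: hi_def)
      qed
    next
      case False
      show ?thesis
      proof (cases "even z")
        case True
        then obtain w where w: "z = 2 * w" by blast
        then obtain i where i: "i \<in> {1..n div 2}" "int i = w"
          using z index_of_nonzero[of w] by auto
        have "H w"
          using H_double[of w] w z False by auto
        then show ?thesis
          using i w by (intro bexI[of _ i]) (auto simp: hi_def)
      next
        case oddz: False
        then have "even (int n - z)"
          using odd_n by simp
        then obtain w where w: "int n - z = 2 * w" by blast
        then obtain i where i: "i \<in> {1..n div 2}" "int i = w"
          using z index_of_nonzero[of w] by auto
        have "\<not> H w"
          using H_double[of w] H_neg[OF z] w z False by auto
        then show ?thesis
          using i w by (intro bexI[of _ i]) (auto simp: lo_def)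
      qed
    qed
    then show "z \<in> (\<Union>i\<in>{1..n div 2}. {lo i, hi i})" by blast
  qed
qed

lemma differences_cover:
  "(\<Union>i\<in>{1..n div 2}. {(lo i - hi i) mod int n, (- (lo i - hi i)) mod int n}) = nonzero_residues n"
proof -
  have "(lo i - hi i) mod int n = int n - int i \<and> (- (lo i - hi i)) mod int n = int i"
    if "i \<in> {1..n div 2}" for i
  proof -
    have "lo i - hi i = - int i"
      using hi_minus_lo[of i] by simp
    then show ?thesis
      using index_bound[OF that] by (simp add: zmod_zminus1_eq_if)
  qed
  then have "(\<Union>i\<in>{1..n div 2}. {(lo i - hi i) mod int n, (- (lo i - hi i)) mod int n})
      = (\<Union>i\<in>{1..n div 2}. {int n - int i, int i})"
    by (intro SUP_cong) auto
  also have "\<dots> = nonzero_residues n"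
  proof (intro equalityI subsetI)
    fix z assume "z \<in> (\<Union>i\<in>{1..n div 2}. {int n - int i, int i})"
    then show "z \<in> nonzero_residues n"
      using index_bound by (fastforce simp: nonzero_residues_def)
  next
    fix z assume "z \<in> nonzero_residues n"
    then have z: "0 < z" "z < int n"
      by (auto simp: nonzero_residues_def)
    have "int n \<noteq> 2 * z"
      using odd_n by presburger
    then consider "2 * z < int n" | "2 * (int n - z) < int n" by force
    then show "z \<in> (\<Union>i\<in>{1..n div 2}. {int n - int i, int i})"
    proof cases
      case 1
      then obtain i where "i \<in> {1..n div 2}" "int i = z"
        using z index_of_nonzero by blast
      then show ?thesis by auto
    next
      case 2
      then obtain i where "i \<in> {1..n div 2}" "int i = int n - z"
        using z index_of_nonzero[of "int n - z"] by auto
      then show ?thesis by force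
    qed
  qed
  finally show ?thesis .
qed

text \<open>
  This is the element of \<open>{i, -i}\<close> that represents the element \<open>z\<close> of the half-set in the pair
  \<open>{z, 2z}\<close>; being of absolute value at most \<open>n div 2\<close>, it can be recovered from its residue class.
\<close>

definition signed_index :: "nat \<Rightarrow> int" where
  "signed_index i = (if H (int i) then int i else - int i)"

lemma sum_cong: "[lo i + hi i = 3 * signed_index i] (mod int n)"
proof (cases "H (int i)")
  case False
  then have "lo i + hi i = 3 * signed_index i + int n * 2"
    by (simp add: lo_def hi_def signed_index_def)
  then show ?thesis
    by (simp add: cong_def)
qed (simp add: lo_def hi_def signed_index_def)

lemma sum_nonzero:
  assumes "i \<in> {1..n div 2}"
  shows "(lo i + hi i) mod int n \<noteq> 0"
proof
  assume "(lo i + hi i) mod int n = 0"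
  then have "int n dvd 3 * signed_index i"
    using sum_cong[of i] by (simp add: cong_def dvd_eq_mod_eq_0)
  then have "int n dvd signed_index i"
    using coprime_3 by (simp add: coprime_dvd_mult_right_iff coprime_commute)
  then have "int n dvd int i"
    by (simp add: signed_index_def split: if_splits)
  then show False
    using index_bound[OF assms] zdvd_imp_le by fastforce
qed

text \<open>
  After cancelling \<open>3\<close>, two equal sums force \<open>n\<close> to divide a number \<open>\<plusminus>i \<plusminus> j\<close>, which has absolute
  value less than \<open>n\<close>.
\<close>

lemma sums_distinct: "inj_on (\<lambda>i. (lo i + hi i) mod int n) {1..n div 2}"
proof (rule inj_onI)
  fix i j
  assume ij: "i \<in> {1..n div 2}" "j \<in> {1..n div 2}"
    and "(lo i + hi i) mod int n = (lo j + hi j) mod int n"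
  then have "[3 * signed_index i = 3 * signed_index j] (mod int n)"
    using sum_cong[of i] sum_cong[of j] by (simp add: cong_def)
  then have "[signed_index i = signed_index j] (mod int n)"
    using coprime_3 by (simp add: cong_mult_lcancel)
  then have "int n dvd signed_index i - signed_index j"
    by (simp add: cong_iff_dvd_diff)
  moreover have "\<bar>signed_index i - signed_index j\<bar> < int n"
    using index_bound[OF ij(1)] index_bound[OF ij(2)] by (auto simp: signed_index_def)
  ultimately have "signed_index i = signed_index j"
    using dvd_imp_le_int[of "signed_index i - signed_index j" "int n"] by auto
  then show "i = j"
    using index_bound[OF ij(1)] index_bound[OF ij(2)] by (auto simp: signed_index_def split: if_splits)
qed

lemma strong_skolem_starter_pairs:
  "strong_skolem_starter n ((\<lambda>i. {lo i, hi i}) ` {1..n div 2})"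
proof -
  let ?S = "(\<lambda>i. {lo i, hi i}) ` {1..n div 2}"
  have enum: "enumerates n ?S lo hi"
    by (simp add: enumerates_def)
  have start: "starter n ?S"
    using odd_n enum pairs_cover differences_cover unfolding starter_def by blast
  have "\<forall>i\<in>{1..n div 2}. (lo i + hi i) mod int n \<noteq> 0"
    by (intro ballI sum_nonzero)
  then have "strong_starter n ?S"
    using start enum sums_distinct unfolding strong_starter_def by blast
  moreover have "\<forall>i\<in>{1..n div 2}. lo i < hi i \<and> [hi i - lo i = int i] (mod int n)"
  proof
    fix i assume "i \<in> {1..n div 2}"
    then show "lo i < hi i \<and> [hi i - lo i = int i] (mod int n)"
      using hi_minus_lo[of i] index_bound[of i] by auto
  qed
  then have "skolem_starter n ?S"
    using start enum unfolding skolem_starter_def by blast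
  ultimately show ?thesis
    by (simp add: strong_skolem_starter_def)
qed

end

section \<open>Legendre symbols modulo primes congruent to 3 modulo 8\<close>

lemma Legendre_range: "Legendre a m \<in> {-1, 0, 1}"
  by (simp add: Legendre_def)

lemma Legendre_cong_eq:
  assumes "[a = b] (mod m)"
  shows "Legendre a m = Legendre b m"
proof -
  have "[a = 0] (mod m) \<longleftrightarrow> [b = 0] (mod m)" "QuadRes m a \<longleftrightarrow> QuadRes m b"
    using assms unfolding QuadRes_def cong_def by auto
  then show ?thesis
    by (simp add: Legendre_def)
qed

lemma Legendre_eqI:
  assumes "2 < r" and "[Legendre a r = e] (mod r)" and "e \<in> {-1, 0, 1}"
  shows "Legendre a r = e"
proof -
  have "r dvd Legendre a r - e"
    using assms(2) by (simp add: cong_iff_dvd_diff)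
  moreover have "\<bar>Legendre a r - e\<bar> \<le> 2"
    using Legendre_range[of a r] assms(3) by auto
  ultimately show ?thesis
    using assms(1) dvd_imp_le_int[of "Legendre a r - e" r] by fastforce
qed

lemma Legendre_mult:
  fixes r :: nat
  assumes "prime r" "2 < r"
  shows "Legendre (a * b) (int r) = Legendre a (int r) * Legendre b (int r)"
proof (rule Legendre_eqI)
  note euler = euler_criterion[OF assms]
  have "[Legendre a r * Legendre b r = (a * b) ^ ((r - 1) div 2)] (mod r)"
    using cong_mult[OF euler[of a] euler[of b]] by (simp add: power_mult_distrib)
  then show "[Legendre (a * b) r = Legendre a r * Legendre b r] (mod r)"
    using euler[of "a * b"] cong_sym cong_trans by blast
  show "Legendre a r * Legendre b r \<in> {-1, 0, 1}"
    using Legendre_range[of a r] Legendre_range[of b r] by auto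
qed (use assms in simp)

lemma cong_3_mod_8_imp_odd: "odd r" if "[r = 3] (mod 8)" for r :: nat
  using that unfolding cong_def by presburger

lemma Legendre_minus_one:
  fixes r :: nat
  assumes "prime r" and "[r = 3] (mod 8)"
  shows "Legendre (- 1) (int r) = - 1"
proof (rule Legendre_eqI)
  have r: "2 < r" "odd ((r - 1) div 2)"
    using assms(2) unfolding cong_def by presburger+
  show "2 < int r" using r by simp
  show "[Legendre (- 1) (int r) = - 1] (mod int r)"
    using euler_criterion[OF assms(1) r(1), of "- 1"] r(2) by simp
qed simp

text \<open>
  With \<open>r = 8m + 3\<close>, the even numbers up to \<open>r - 1\<close> that exceed \<open>(r - 1) / 2 = 4m + 1\<close> are the doubles
  of \<open>2m + 1, \<dots>, 4m + 1\<close>. Their number \<open>2m + 1\<close> is odd, and it is the exponent of \<open>-1\<close> in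
  Gauss' lemma.
\<close>

lemma Legendre_two:
  fixes r :: nat
  assumes "prime r" and "[r = 3] (mod 8)"
  shows "Legendre 2 (int r) = - 1"
proof -
  define m where "m = r div 8"
  have r: "r = 8 * m + 3"
    using assms(2) unfolding m_def cong_def by presburger
  interpret G: GAUSS r 2
  proof
    show "[2 \<noteq> 0] (mod int r)"
      using r by (simp add: cong_def)
  qed (use assms r in auto)
  have half: "(int r - 1) div 2 = 4 * int m + 1"
    using r by simp
  have "G.C = (\<lambda>x. 2 * x) ` {0 <.. 4 * int m + 1}"
    unfolding G.C_def G.B_def G.A_def half image_image
    by (rule image_cong) (use r in auto)
  then have "G.E = (\<lambda>x. 2 * x) ` {2 * int m + 1 .. 4 * int m + 1}"
    unfolding G.E_def half by auto
  then have "card G.E = card {2 * int m + 1 .. 4 * int m + 1}"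
    by (simp add: card_image inj_on_def)
  also have "\<dots> = 2 * m + 1"
    by simp
  finally show ?thesis
    using G.gauss_lemma by simp
qed

lemma
  fixes r :: nat
  assumes "prime r" and "[r = 3] (mod 8)" and "\<not> int r dvd a"
  shows Legendre_minus_iff: "Legendre (- a) (int r) = 1 \<longleftrightarrow> Legendre a (int r) \<noteq> 1"
    and Legendre_double_iff: "Legendre (2 * a) (int r) = 1 \<longleftrightarrow> Legendre a (int r) \<noteq> 1"
proof -
  have "2 < r"
    using assms(2) unfolding cong_def by presburger
  note mult = Legendre_mult[OF assms(1) this]
  have a: "Legendre a r = 1 \<or> Legendre a r = - 1"
    using assms(3) by (simp add: Legendre_def cong_0_iff)
  show "Legendre (- a) (int r) = 1 \<longleftrightarrow> Legendre a (int r) \<noteq> 1"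
    using a mult[of "- 1" a] Legendre_minus_one[OF assms(1,2)] by auto
  show "Legendre (2 * a) (int r) = 1 \<longleftrightarrow> Legendre a (int r) \<noteq> 1"
    using a mult[of 2 a] Legendre_two[OF assms(1,2)] by auto
qed

section \<open>The product of two primes\<close>

text \<open>
  A multiple of \<open>p\<close> strictly between \<open>0\<close> and \<open>p * q\<close> is not a multiple of \<open>q\<close>, so the symbol that
  is consulted is never zero; and \<open>z\<close>, \<open>-z\<close>, \<open>2z\<close> all consult the same one.
\<close>

lemma alternating_half_set_Legendre:
  fixes p q :: nat
  assumes "prime p" "prime q" "p \<noteq> q" "[p = 3] (mod 8)" "[q = 3] (mod 8)" "p \<noteq> 3" "q \<noteq> 3"
  shows "alternating_half_set (p * q)
    (\<lambda>z. Legendre z (if int p dvd z then int q else int p) = 1)"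
proof
  have odd: "odd p" "odd q"
    using cong_3_mod_8_imp_odd assms(4,5) by blast+
  then show "odd (p * q)" by simp
  have "coprime 3 p" "coprime 3 q"
    using assms by (auto intro!: primes_coprime)
  then have "coprime 3 (p * q)" by simp
  then show "coprime 3 (int (p * q))"
    using coprime_int_iff[of 3 "p * q"] by simp
  have coprime_pq: "coprime (int p) (int q)"
    using assms by (simp add: primes_coprime)
  have not_q: "\<not> int q dvd z" if "0 < z" "z < int (p * q)" "int p dvd z" for z
  proof
    assume "int q dvd z"
    with that coprime_pq have "int p * int q dvd z"
      by (simp add: divides_mult)
    with that show False
      using zdvd_not_zless[of z "int (p * q)"] by simp
  qed
  show "Legendre (int (p * q) - z) (if int p dvd int (p * q) - z then int q else int p) = 1
    \<longleftrightarrow> \<not> Legendre z (if int p dvd z then int q else int p) = 1"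
    if z: "0 < z" "z < int (p * q)" for z
  proof -
    have dvd: "int p dvd int (p * q) - z \<longleftrightarrow> int p dvd z"
      by (simp add: dvd_diff_right_iff)
    have "Legendre (int (p * q) - z) p = Legendre (- z) p"
      "Legendre (int (p * q) - z) q = Legendre (- z) q"
      by (auto intro!: Legendre_cong_eq simp: cong_iff_dvd_diff)
    then show ?thesis
      using dvd not_q[OF z] Legendre_minus_iff[OF assms(1,4), of z]
        Legendre_minus_iff[OF assms(2,5), of z]
      by simp
  qed
  show "Legendre (2 * z) (if int p dvd 2 * z then int q else int p) = 1
    \<longleftrightarrow> \<not> Legendre z (if int p dvd z then int q else int p) = 1"
    if z: "0 < z" "2 * z < int (p * q)" for z
  proof -
    have "coprime (int p) 2"
      using odd by simp
    then have dvd: "int p dvd 2 * z \<longleftrightarrow> int p dvd z"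
      by (simp add: coprime_dvd_mult_right_iff)
    have "z < int (p * q)" using z by linarith
    then show ?thesis
      using dvd not_q[of z] z(1) Legendre_double_iff[OF assms(1,4), of z]
        Legendre_double_iff[OF assms(2,5), of z]
      by simp
  qed
qed

theorem theorem1p2:
  fixes p q :: nat
  assumes "prime p" and "odd p" and "prime q" and "odd q"
    and "[p = 3] (mod 8)" and "[q = 3] (mod 8)"
    and "p < q"
    and "\<not> (p - 1) dvd (q - 1)"
  shows "\<exists>S. strong_skolem_starter (p * q) S"
proof -
  have "p \<noteq> 3"
    using assms by auto
  moreover have "3 \<le> p"
    using assms(5) unfolding cong_def by presburger
  ultimately have "p \<noteq> 3" "q \<noteq> 3"
    using \<open>p < q\<close> by auto
  with assms interpret alternating_half_set "p * q"
      "\<lambda>z. Legendre z (if int p dvd z then int q else int p) = 1"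
    by (intro alternating_half_set_Legendre) auto
  show ?thesis
    using strong_skolem_starter_pairs by blast
qed

end
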